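(* For each cardinal $\kappa<\mathfrak{par}_2$, the space $2^\kappa$ is $r$-Ramsey for all integers $r\geq 1$. Moreover, $2^{\mathfrak{par}_2}$ is not $2$-Ramsey.
   Context: For a set $S$ and a positive integer $r$, $[S]^r$ denotes the set of all $r$-element subsets of $S$. For an infinite set $S\subseteq\omega$ and a topological space $X$, a function $f\colon[S]^r\to X$ converges to $p\in X$ if for every neighborhood $U$ of $p$ there is a finite set $F$ such that $f(s)\in U$ for all $s\in[S\setminus F]^r$. A space $X$ is $r$-Ramsey if for every function $f\colon[\omega]^r\to X$ there are $p\in X$ and an infinite set $B\subseteq\omega$ such that $f\restriction[B]^r$ converges to $p$. Here $2^\kappa$ is the Cantor cube: the product of $\kappa$ copies of the discrete two-point space $2=\{0,1\}$. A set $A\subseteq\omega$ is almost homogeneous for a partition $f\colon[\omega]^n\to 2$ if there is a finite $F\subseteq A$ such that $f$ is constant on $[A\setminus F]^n$. The cardinal $\mathfrak{par}_n$ is the smallest cardinal $\kappa$ such that there is a family of $\kappa$ many partitions $[\omega]^n\to 2$ for which no infinite subset of $\omega$ is almost homogeneous for all of them simultaneously. *)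

theory Defs
  imports "HOL-Analysis.Analysis" "HOL-Library.Ramsey"
begin

unbundle cardinal_syntax

definition nsets_converges ::
    "'a topology \<Rightarrow> nat \<Rightarrow> nat set \<Rightarrow> (nat set \<Rightarrow> 'a) \<Rightarrow> 'a \<Rightarrow> bool" where
  "nsets_converges X r S f p \<longleftrightarrow>
     (\<forall>U. openin X U \<and> p \<in> U \<longrightarrow> (\<exists>F. finite F \<and> (\<forall>s\<in>[S - F]\<^bsup>r\<^esup>. f s \<in> U)))"

definition ramsey_space :: "nat \<Rightarrow> 'a topology \<Rightarrow> bool" where
  "ramsey_space r X \<longleftrightarrow>
     (\<forall>f \<in> [UNIV]\<^bsup>r\<^esup> \<rightarrow> topspace X.
        \<exists>p\<in>topspace X. \<exists>B. infinite B \<and> nsets_converges X r B f p)"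

text \<open>
  Cardinals are represented, as in the BNF cardinal library, by relations \<open>\<kappa>\<close> with
  \<open>Card_order \<kappa>\<close>; the underlying set of size \<open>\<kappa>\<close> is \<open>Field \<kappa>\<close>. Replacing
  \<open>\<kappa>\<close> by an isomorphic \<open>\<mu> =o \<kappa>\<close> changes the cube below only up to
  homeomorphism.
\<close>

definition cantor_cube :: "'k rel \<Rightarrow> ('k \<Rightarrow> bool) topology" where
  "cantor_cube \<kappa> = product_topology (\<lambda>_. discrete_topology (UNIV :: bool set)) (Field \<kappa>)"

definition almost_homogeneous :: "nat \<Rightarrow> (nat set \<Rightarrow> bool) \<Rightarrow> nat set \<Rightarrow> bool" where
  "almost_homogeneous n f A \<longleftrightarrow> (\<exists>F\<subseteq>A. finite F \<and> f constant_on [A - F]\<^bsup>n\<^esup>)"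

text \<open>
  Partitions are taken to be extensional functions on \<open>[UNIV]\<^bsup>n\<^esup>\<close>, so that the
  cardinality of a set of partitions does not depend on values at irrelevant arguments.
\<close>

definition par_family :: "nat \<Rightarrow> (nat set \<Rightarrow> bool) set \<Rightarrow> bool" where
  "par_family n P \<longleftrightarrow>
     P \<subseteq> [UNIV]\<^bsup>n\<^esup> \<rightarrow>\<^sub>E UNIV \<and>
     \<not> (\<exists>A. infinite A \<and> (\<forall>f\<in>P. almost_homogeneous n f A))"

text \<open>
  The least cardinality of such a family. The choice is unique up to \<open>=o\<close>, and the least
  cardinality exists for \<open>n > 0\<close> by lemma \<open>par_least\<close> below.
\<close>

definition par :: "nat \<Rightarrow> (nat set \<Rightarrow> bool) rel" where
  "par n = (SOME \<kappa>. Card_order \<kappa> \<and> (\<exists>P. par_family n P \<and> |P| =o \<kappa>) \<and>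
                   (\<forall>P. par_family n P \<longrightarrow> \<kappa> \<le>o |P| ))"

lemma par_family_all:
  assumes "n > 0"
  shows "par_family n ([UNIV]\<^bsup>n\<^esup> \<rightarrow>\<^sub>E UNIV)"
  unfolding par_family_def
proof (intro conjI notI)
  assume "\<exists>A. infinite A \<and> (\<forall>f\<in>[UNIV]\<^bsup>n\<^esup> \<rightarrow>\<^sub>E UNIV. almost_homogeneous n f A)"
  then obtain A :: "nat set" where A: "infinite A"
    and hom: "\<And>f. f \<in> [UNIV]\<^bsup>n\<^esup> \<rightarrow>\<^sub>E UNIV \<Longrightarrow> almost_homogeneous n f A" by blast
  obtain C D where CD: "C \<subseteq> A" "D \<subseteq> A" "infinite C" "infinite D" "C \<inter> D = {}"
    using infinite_split[OF A] by metis
  define f where "f = (\<lambda>s\<in>[UNIV]\<^bsup>n\<^esup>. s \<subseteq> C)"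
  have "almost_homogeneous n f A"
    by (rule hom) (auto simp: f_def)
  then obtain F c where F: "finite F" "\<And>s. s \<in> [A - F]\<^bsup>n\<^esup> \<Longrightarrow> f s = c"
    unfolding almost_homogeneous_def constant_on_def by blast
  obtain s where s: "s \<subseteq> C - F" "finite s" "card s = n"
    using infinite_arbitrarily_large[of "C - F" n] CD F(1) by auto
  obtain t where t: "t \<subseteq> D - F" "finite t" "card t = n"
    using infinite_arbitrarily_large[of "D - F" n] CD F(1) by auto
  have "s \<in> [A - F]\<^bsup>n\<^esup>" "t \<in> [A - F]\<^bsup>n\<^esup>"
    using s t CD unfolding nsets_def by blast+
  moreover have "f s" using s by (auto simp: f_def nsets_def)
  moreover have "t \<noteq> {}" using t assms by auto
  then have "\<not> f t" using t CD by (auto simp: f_def nsets_def)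
  ultimately show False using F(2) by metis
qed simp

lemma par_least:
  assumes "n > 0"
  shows "Card_order (par n)" "\<exists>P. par_family n P \<and> |P| =o par n"
    and "par_family n P \<Longrightarrow> par n \<le>o |P|"
proof -
  let ?R = "card_of ` {P. par_family n P}"
  have "?R \<noteq> {}" using par_family_all[OF assms] by blast
  then obtain P0 where "par_family n P0" "\<And>P. par_family n P \<Longrightarrow> |P0| \<le>o |P|"
    using exists_minim_Card_order[of ?R] card_of_Card_order by auto
  then have "\<exists>\<kappa> :: (nat set \<Rightarrow> bool) rel. Card_order \<kappa> \<and>
      (\<exists>P. par_family n P \<and> |P| =o \<kappa>) \<and> (\<forall>P. par_family n P \<longrightarrow> \<kappa> \<le>o |P| )"
    by (intro exI[of _ "|P0|"]) (auto intro: card_of_refl card_of_Card_order)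
  from someI_ex[OF this] show "Card_order (par n)" "\<exists>P. par_family n P \<and> |P| =o par n"
    "par_family n P \<Longrightarrow> par n \<le>o |P|"
    unfolding par_def by blast+
qed

end

(* Convergence in 2^\<kappa> of a function on [B]^r is almost homogeneity of B for its \<kappa> coordinates,
   so the theorem says that fewer than par_2 partitions of [\<omega>]^r always have a common almost
   homogeneous set. This follows from the case r = 2 with the same index set, by induction on r.
   First, shrinking to A makes f(a \<union> {x}) converge, as x runs through A, to a limit g(a) for every
   finite set a: colour {x < y} by whether the sequence of all values f(a \<union> {x}), over all a, is
   lexicographically below the one for y; on a homogeneous set these sequences are monotone, hence
   converge. Next, shrink so that g is almost constant on r-sets. Last, shrink so that the elements
   grow faster than the thresholds from which f(a \<union> {x}) = g(a), which is again a colouring of pairs. *)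
theory Submission
  imports Defs "HOL-Library.Nat_Bijection"
begin

section \<open>Almost homogeneous sets and their exceptional sets\<close>

lemma almost_homogeneousI:
  assumes "finite F" "\<And>s. s \<in> [A - F]\<^bsup>n\<^esup> \<Longrightarrow> f s = c"
  shows "almost_homogeneous n f A"
  unfolding almost_homogeneous_def constant_on_def
proof (intro exI conjI ballI)
  show "A \<inter> F \<subseteq> A" "finite (A \<inter> F)"
    using assms(1) by auto
  show "f s = c" if "s \<in> [A - A \<inter> F]\<^bsup>n\<^esup>" for s
    using that assms(2) by (simp add: Diff_Int2[symmetric] Diff_Int)
qed

lemma almost_homogeneousE:
  assumes "almost_homogeneous n f A"
  obtains F c where "finite F" "\<And>s. s \<in> [A - F]\<^bsup>n\<^esup> \<Longrightarrow> f s = c"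
  using assms unfolding almost_homogeneous_def constant_on_def by blast

lemma almost_homogeneous_subset:
  assumes "almost_homogeneous n f A" "B \<subseteq> A"
  shows "almost_homogeneous n f B"
proof -
  obtain F c where F: "finite F" "\<And>s. s \<in> [A - F]\<^bsup>n\<^esup> \<Longrightarrow> f s = c"
    using assms(1) by (rule almost_homogeneousE) (rule that)
  show ?thesis
  proof (rule almost_homogeneousI[OF F(1)])
    show "f s = c" if "s \<in> [B - F]\<^bsup>n\<^esup>" for s
      using that assms(2) by (intro F(2)) (auto simp: nsets_def)
  qed
qed

section \<open>Families of colourings over a fixed index set\<close>

text \<open>Colourings are indexed by \<open>I\<close> rather than collected in a set, so that the
  induction on the exponent can keep \<open>I\<close> while the colourings change. Only the values
  of \<open>f i\<close> on \<open>n\<close>-sets matter.\<close>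

definition homogenizable :: "nat \<Rightarrow> 'i set \<Rightarrow> bool" where
  "homogenizable n I \<longleftrightarrow>
     (\<forall>f. \<exists>A. infinite A \<and> (\<forall>i\<in>I. almost_homogeneous n (f i) A))"

text \<open>Pull the colourings back along an enumeration of \<open>B\<close> and push the resulting
  set forward. This allows repeated shrinking, each time inside the set found before.\<close>

lemma homogenizable_within:
  assumes "homogenizable n I" "infinite B"
  obtains A where "A \<subseteq> B" "infinite A" "\<And>i. i \<in> I \<Longrightarrow> almost_homogeneous n (f i) A"
proof -
  define e where "e = enumerate B"
  have inj: "inj e" and ran: "range e = B"
    using assms(2) strict_mono_enumerate[of B] range_enumerate[of B]
    by (auto simp: e_def strict_mono_imp_inj_on)
  obtain A where A: "infinite A" "\<And>i. i \<in> I \<Longrightarrow> almost_homogeneous n (\<lambda>s. f i (e ` s)) A"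
    using assms(1)[unfolded homogenizable_def, rule_format, of "\<lambda>i s. f i (e ` s)"] by blast
  show thesis
  proof
    show "e ` A \<subseteq> B" "infinite (e ` A)"
      using ran A(1) inj by (auto simp: finite_image_iff inj_on_subset)
    fix i assume "i \<in> I"
    then obtain F c where F: "finite F" "\<And>s. s \<in> [A - F]\<^bsup>n\<^esup> \<Longrightarrow> f i (e ` s) = c"
      by (rule almost_homogeneousE[OF A(2)]) (rule that)
    show "almost_homogeneous n (f i) (e ` A)"
    proof (rule almost_homogeneousI)
      show "finite (e ` F)"
        using F(1) by simp
      fix s assume s: "s \<in> [e ` A - e ` F]\<^bsup>n\<^esup>"
      then have "s \<subseteq> e ` (A - F)"
        by (auto simp: nsets_def)
      then obtain t where t: "t \<subseteq> A - F" "s = e ` t"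
        by (rule subset_imageE)
      then have "t \<in> [A - F]\<^bsup>n\<^esup>"
        using s inj by (auto simp: nsets_def card_image finite_image_iff inj_on_subset)
      then show "f i s = c"
        using F(2) t by simp
    qed
  qed
qed

text \<open>The colourings of pairs give at most \<open>|I|\<close> many partitions, too few for a
  \<open>par_family\<close>.\<close>

lemma homogenizable_2I:
  assumes "|I| <o par 2"
  shows "homogenizable 2 I"
  unfolding homogenizable_def
proof
  fix f :: "'a \<Rightarrow> nat set \<Rightarrow> bool"
  \<comment> \<open>Restriction makes the partitions extensional, as \<open>par_family\<close>
    demands, and keeps their values on pairs.\<close>
  define P where "P = (\<lambda>i. restrict (f i) ([UNIV]\<^bsup>2\<^esup>)) ` I"
  have "|P| <o par 2"
    using card_of_image assms unfolding P_def by (rule ordLeq_ordLess_trans)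
  then have "\<not> par_family 2 P"
    using par_least(3)[of 2 P] not_ordLess_ordLeq by auto
  moreover have "P \<subseteq> [UNIV]\<^bsup>2\<^esup> \<rightarrow>\<^sub>E UNIV"
    by (auto simp: P_def)
  ultimately obtain A where A: "infinite A" "\<And>g. g \<in> P \<Longrightarrow> almost_homogeneous 2 g A"
    unfolding par_family_def by blast
  have "almost_homogeneous 2 (f i) A" if "i \<in> I" for i
  proof -
    have "almost_homogeneous 2 (restrict (f i) ([UNIV]\<^bsup>2\<^esup>)) A"
      using A(2) that by (auto simp: P_def)
    then obtain F c where F: "finite F"
      "\<And>s. s \<in> [A - F]\<^bsup>2\<^esup> \<Longrightarrow> restrict (f i) ([UNIV]\<^bsup>2\<^esup>) s = c"
      by (rule almost_homogeneousE) (rule that)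
    show ?thesis
    proof (rule almost_homogeneousI[OF F(1)])
      fix s assume s: "s \<in> [A - F]\<^bsup>2\<^esup>"
      then have "s \<in> [UNIV]\<^bsup>2\<^esup>"
        by (simp add: nsets_def)
      then show "f i s = c"
        using F(2)[OF s] by simp
    qed
  qed
  then show "\<exists>A. infinite A \<and> (\<forall>i\<in>I. almost_homogeneous 2 (f i) A)"
    using A(1) by blast
qed

lemma pair_in_nsets_2:
  fixes x y :: nat
  assumes "x \<in> A" "y \<in> A" "x < y"
  shows "{x, y} \<in> [A]\<^bsup>2\<^esup>"
  using assms by (auto simp: nsets_def)

text \<open>Give each pair the colour of its minimum: in an infinite set, every point outside the
  finite set \<open>F\<close> is the minimum of a pair avoiding \<open>F\<close>.\<close>

lemma homogenizable_1I:
  assumes "homogenizable 2 I"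
  shows "homogenizable 1 I"
  unfolding homogenizable_def
proof
  fix f :: "'a \<Rightarrow> nat set \<Rightarrow> bool"
  obtain A where A: "infinite A" "\<And>i. i \<in> I \<Longrightarrow> almost_homogeneous 2 (\<lambda>s. f i {Min s}) A"
    by (rule homogenizable_within[OF assms infinite_UNIV_nat, of "\<lambda>i s. f i {Min s}"]) blast
  have "almost_homogeneous 1 (f i) A" if "i \<in> I" for i
  proof -
    obtain F c where F: "finite F" "\<And>s. s \<in> [A - F]\<^bsup>2\<^esup> \<Longrightarrow> f i {Min s} = c"
      using A(2)[OF \<open>i \<in> I\<close>] by (rule almost_homogeneousE) (rule that)
    show ?thesis
    proof (rule almost_homogeneousI[OF F(1)])
      fix s assume "s \<in> [A - F]\<^bsup>1\<^esup>"
      then obtain x where x: "s = {x}" "x \<in> A - F"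
        by (auto simp: nsets_def card_1_singleton_iff)
      obtain y where y: "y \<in> A - F" "x < y"
        using A(1) F(1) infinite_nat_iff_unbounded[of "A - F"] by auto
      have "Min {x, y} = x"
        using y by simp
      then show "f i s = c"
        using F(2)[OF pair_in_nsets_2[OF x(2) y]] x(1) by simp
    qed
  qed
  then show "\<exists>A. infinite A \<and> (\<forall>i\<in>I. almost_homogeneous 1 (f i) A)"
    using A(1) by blast
qed

section \<open>Monotone and lexicographically ordered Boolean sequences\<close>

text \<open>A monotone Boolean sequence switches its value at most once.\<close>

lemma eventually_const_if_monotone:
  fixes v :: "nat \<Rightarrow> bool"
  assumes "(\<forall>x\<in>A. \<forall>y\<in>A. N \<le> x \<and> x < y \<longrightarrow> v x \<longrightarrow> v y) \<or>
    (\<forall>x\<in>A. \<forall>y\<in>A. N \<le> x \<and> x < y \<longrightarrow> v y \<longrightarrow> v x)"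
  shows "\<exists>M c. \<forall>x\<in>A. M \<le> x \<longrightarrow> v x = c"
  using assms
proof
  assume mono: "\<forall>x\<in>A. \<forall>y\<in>A. N \<le> x \<and> x < y \<longrightarrow> v x \<longrightarrow> v y"
  show ?thesis
  proof (cases "\<exists>x\<in>A. N \<le> x \<and> v x")
    case True
    then obtain x where "x \<in> A" "N \<le> x" "v x" by blast
    with mono show ?thesis
      by (intro exI[of _ "Suc x"] exI[of _ True]) auto
  qed blast
next
  assume mono: "\<forall>x\<in>A. \<forall>y\<in>A. N \<le> x \<and> x < y \<longrightarrow> v y \<longrightarrow> v x"
  show ?thesis
  proof (cases "\<exists>x\<in>A. N \<le> x \<and> \<not> v x")
    case True
    then obtain x where "x \<in> A" "N \<le> x" "\<not> v x" by blast
    with mono show ?thesis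
      by (intro exI[of _ "Suc x"] exI[of _ False]) auto
  qed blast
qed

text \<open>By induction on \<open>n\<close>, the first \<open>n\<close> bits of \<open>u x\<close>
  do not depend on \<open>x\<close> for large \<open>x\<close> in \<open>A\<close>. Among such rows,
  a constant truth value \<open>c\<close> of \<open>lt\<close> makes bit \<open>n\<close> monotone
  in \<open>x\<close>, hence eventually constant.\<close>

lemma lex_homogeneous_converges:
  fixes u :: "nat \<Rightarrow> nat \<Rightarrow> bool"
  assumes lt: "\<And>x y. lt x y \<longleftrightarrow> (\<exists>n. (\<forall>m<n. u x m = u y m) \<and> \<not> u x n \<and> u y n)"
    and hom: "almost_homogeneous 2 (\<lambda>s. lt (Min s) (Max s)) A"
  shows "\<exists>N c. \<forall>x\<in>A. N \<le> x \<longrightarrow> u x n = c"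
proof -
  obtain F c where F: "finite F" "\<And>s. s \<in> [A - F]\<^bsup>2\<^esup> \<Longrightarrow> lt (Min s) (Max s) = c"
    using hom by (rule almost_homogeneousE) (rule that)
  obtain K where K: "\<And>x. x \<in> F \<Longrightarrow> x < K"
    using F(1) finite_nat_set_iff_bounded by auto
  have lt_c: "lt x y = c" if "x \<in> A" "y \<in> A" "K \<le> x" "x < y" for x y
  proof -
    have "{x, y} \<in> [A - F]\<^bsup>2\<^esup>"
      using that K[of x] K[of y] by (intro pair_in_nsets_2) auto
    moreover have "Min {x, y} = x" "Max {x, y} = y"
      using that by auto
    ultimately show ?thesis
      using F(2) by metis
  qed
  have "\<exists>N. \<forall>x\<in>A. \<forall>y\<in>A. N \<le> x \<and> N \<le> y \<longrightarrow> (\<forall>m<n. u x m = u y m)" for n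
  proof (induction n)
    case (Suc n)
    then obtain N where *:
      "\<forall>x\<in>A. \<forall>y\<in>A. N \<le> x \<and> N \<le> y \<longrightarrow> (\<forall>m<n. u x m = u y m)"
      by (elim exE) (rule that)
    have N: "u x m = u y m" if "x \<in> A" "y \<in> A" "N \<le> x" "N \<le> y" "m < n" for x y m
      using *[rule_format, of x y m] that by simp
    have "\<exists>M c. \<forall>x\<in>A. M \<le> x \<longrightarrow> u x n = c"
    proof (rule eventually_const_if_monotone[of _ "max K N"], cases c)
      case True
      have "u y n" if xy: "x \<in> A" "y \<in> A" "max K N \<le> x" "x < y" "u x n" for x y
      proof -
        \<comment> \<open>The rows first differ at \<open>k\<close>, which cannot lie among the
          first \<open>n\<close> bits. So either \<open>k = n\<close>, or bit \<open>n\<close>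
          agrees as well.\<close>
        obtain k where k: "\<forall>m<k. u x m = u y m" "\<not> u x k" "u y k"
          using lt_c[of x y] xy True by (auto simp: lt)
        then have "n \<le> k"
          using N[of x y k] xy by (auto intro: leI)
        then show ?thesis
          using k xy by (cases "n = k") auto
      qed
      then show "(\<forall>x\<in>A. \<forall>y\<in>A. max K N \<le> x \<and> x < y \<longrightarrow> u x n \<longrightarrow> u y n) \<or>
        (\<forall>x\<in>A. \<forall>y\<in>A. max K N \<le> x \<and> x < y \<longrightarrow> u y n \<longrightarrow> u x n)"
        by blast
    next
      case False
      \<comment> \<open>Otherwise \<open>n\<close> itself would witness
        \<open>lt x y\<close>.\<close>
      have "u x n" if xy: "x \<in> A" "y \<in> A" "max K N \<le> x" "x < y" "u y n" for x y
        using lt_c[of x y] xy False N[of x y] by (auto simp: lt)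
      then show "(\<forall>x\<in>A. \<forall>y\<in>A. max K N \<le> x \<and> x < y \<longrightarrow> u x n \<longrightarrow> u y n) \<or>
        (\<forall>x\<in>A. \<forall>y\<in>A. max K N \<le> x \<and> x < y \<longrightarrow> u y n \<longrightarrow> u x n)"
        by blast
    qed
    then obtain M c where M: "\<forall>x\<in>A. M \<le> x \<longrightarrow> u x n = c"
      by (elim exE) (rule that)
    have eq: "u x m = u y m"
      if "x \<in> A" "y \<in> A" "max M N \<le> x" "max M N \<le> y" "m < Suc n" for x y m
      using that M N[of x y m] by (cases "m = n") (simp_all add: less_Suc_eq)
    show ?case
      by (intro exI[of _ "max M N"] ballI impI allI, rule eq) simp_all
  qed simp
  \<comment> \<open>The first \<open>Suc n\<close> bits include bit \<open>n\<close>.\<close>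
  from this[of "Suc n"] obtain N where
    N: "\<forall>x\<in>A. \<forall>y\<in>A. N \<le> x \<and> N \<le> y \<longrightarrow> (\<forall>m<Suc n. u x m = u y m)"
    by (elim exE) (rule that)
  show ?thesis
  proof (cases "\<exists>y\<in>A. N \<le> y")
    case True
    then obtain y where "y \<in> A" "N \<le> y" by blast
    then have "u x n = u y n" if "x \<in> A" "N \<le> x" for x
      using N[rule_format, of x y n] that by simp
    then show ?thesis
      by (intro exI[of _ N] exI[of _ "u y n"] ballI impI)
  qed blast
qed

section \<open>Limits, fast growth, and the induction on the exponent\<close>

lemma homogenizable_limits:
  fixes f :: "'i \<Rightarrow> nat set \<Rightarrow> bool"
  assumes "homogenizable 2 I"
  obtains A g h where "infinite A"
    "\<And>i a x. \<lbrakk>i \<in> I; finite a; x \<in> A; h i a \<le> x\<rbrakk> \<Longrightarrow> f i (insert x a) = g i a"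
proof -
  \<comment> \<open>\<open>set_decode\<close> enumerates all finite sets, so the row
    \<open>u i x\<close> records the values for every finite \<open>a\<close> at once. Thus one
    colouring of pairs per index \<open>i\<close> suffices.\<close>
  define u where "u i x n = f i (insert x (set_decode n))" for i x n
  define lt where
    "lt i x y \<longleftrightarrow> (\<exists>n. (\<forall>m<n. u i x m = u i y m) \<and> \<not> u i x n \<and> u i y n)" for i x y
  obtain A where A: "infinite A"
    "\<And>i. i \<in> I \<Longrightarrow> almost_homogeneous 2 (\<lambda>s. lt i (Min s) (Max s)) A"
    by (rule homogenizable_within[OF assms infinite_UNIV_nat, of "\<lambda>i s. lt i (Min s) (Max s)"]) blast
  have "\<exists>N c. \<forall>x\<in>A. N \<le> x \<longrightarrow> f i (insert x a) = c" if "i \<in> I" "finite a" for i a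
    using lex_homogeneous_converges[OF lt_def A(2)[OF that(1)], of "set_encode a"]
      that(2) by (simp add: u_def)
  then obtain h g where
    "\<And>i a x. \<lbrakk>i \<in> I; finite a; x \<in> A; h i a \<le> x\<rbrakk> \<Longrightarrow> f i (insert x a) = g i a"
    by metis
  with A(1) that show thesis by blast
qed

text \<open>Only finitely many \<open>a\<close> lie in \<open>{..x}\<close>, so every sufficiently
  large \<open>y\<close> bounds their thresholds. Hence the homogeneous colour of "\<open>y\<close>
  is large enough for \<open>x\<close>" must be true.\<close>

lemma homogenizable_dominating:
  fixes h :: "'i \<Rightarrow> nat set \<Rightarrow> nat"
  assumes "homogenizable 2 I" "infinite B"
  obtains C where "C \<subseteq> B" "infinite C"
    "\<And>i. i \<in> I \<Longrightarrow> \<exists>F. finite F \<and>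
        (\<forall>x\<in>C - F. \<forall>y\<in>C - F. x < y \<longrightarrow> (\<forall>a\<subseteq>{..x}. h i a \<le> y))"
proof -
  define d where "d i s \<longleftrightarrow> (\<forall>a\<subseteq>{..Min s}. h i a \<le> Max s)" for i s
  obtain C where C: "C \<subseteq> B" "infinite C" "\<And>i. i \<in> I \<Longrightarrow> almost_homogeneous 2 (d i) C"
    by (rule homogenizable_within[OF assms, of d]) blast
  have "\<exists>F. finite F \<and> (\<forall>x\<in>C - F. \<forall>y\<in>C - F. x < y \<longrightarrow> (\<forall>a\<subseteq>{..x}. h i a \<le> y))"
    if i: "i \<in> I" for i
  proof -
    obtain F c where F: "finite F" "\<And>s. s \<in> [C - F]\<^bsup>2\<^esup> \<Longrightarrow> d i s = c"
      using C(3)[OF i] by (rule almost_homogeneousE) (rule that)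
    have d: "(\<forall>a\<subseteq>{..x}. h i a \<le> y) = c" if "x \<in> C - F" "y \<in> C - F" "x < y" for x y
    proof -
      have "Min {x, y} = x" "Max {x, y} = y"
        using that by auto
      with F(2)[OF pair_in_nsets_2[OF that]] show ?thesis
        unfolding d_def by metis
    qed
    have inf: "infinite (C - F)"
      using C(2) F(1) by simp
    then obtain x where x: "x \<in> C - F"
      using infinite_imp_nonempty by blast
    \<comment> \<open>This single pair lies beyond all thresholds for \<open>x\<close> and so
      decides the colour \<open>c\<close>.\<close>
    obtain y where y: "y \<in> C - F" "max x (Max (h i ` Pow {..x})) < y"
      using inf infinite_nat_iff_unbounded[of "C - F"] by blast
    have "h i a \<le> y" if "a \<subseteq> {..x}" for a
    proof -
      have "h i a \<le> Max (h i ` Pow {..x})"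
        using that by (intro Max_ge) auto
      then show ?thesis using y(2) by simp
    qed
    then have c
      using d[OF x y(1)] y(2) by simp
    then have "\<forall>a\<subseteq>{..x}. h i a \<le> y" if "x \<in> C - F" "y \<in> C - F" "x < y" for x y
      using d[OF that] by simp
    with F(1) show ?thesis
      by (intro exI[of _ F] conjI ballI impI) simp_all
  qed
  with C that show thesis by blast
qed

text \<open>Split off the maximum \<open>y\<close> of a \<open>Suc r\<close>-set \<open>s\<close>.
  Its distance from the rest \<open>a\<close> guarantees \<open>f i s = g i a\<close>, and
  \<open>g i\<close> is almost constant on \<open>r\<close>-sets.\<close>

lemma homogenizable_Suc:
  assumes "homogenizable 2 I" "homogenizable r I" "r > 0"
  shows "homogenizable (Suc r) I"
  unfolding homogenizable_def
proof
  fix f :: "'a \<Rightarrow> nat set \<Rightarrow> bool"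
  obtain A g h where A: "infinite A" and
    lim: "\<And>i a x. \<lbrakk>i \<in> I; finite a; x \<in> A; h i a \<le> x\<rbrakk> \<Longrightarrow> f i (insert x a) = g i a"
    by (rule homogenizable_limits[OF assms(1), of f]) blast
  obtain B where B: "B \<subseteq> A" "infinite B" "\<And>i. i \<in> I \<Longrightarrow> almost_homogeneous r (g i) B"
    by (rule homogenizable_within[OF assms(2) A, of g]) blast
  obtain C where C: "C \<subseteq> B" "infinite C" and
    dom: "\<And>i. i \<in> I \<Longrightarrow> \<exists>F. finite F \<and>
        (\<forall>x\<in>C - F. \<forall>y\<in>C - F. x < y \<longrightarrow> (\<forall>a\<subseteq>{..x}. h i a \<le> y))"
    by (rule homogenizable_dominating[OF assms(1) B(2), of h]) blast
  have "almost_homogeneous (Suc r) (f i) C" if i: "i \<in> I" for i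
  proof -
    obtain F c where F: "finite F" "\<And>s. s \<in> [C - F]\<^bsup>r\<^esup> \<Longrightarrow> g i s = c"
      using almost_homogeneous_subset[OF B(3)[OF i] C(1)] by (rule almost_homogeneousE) (rule that)
    obtain G where G: "finite G"
      "\<forall>x\<in>C - G. \<forall>y\<in>C - G. x < y \<longrightarrow> (\<forall>a\<subseteq>{..x}. h i a \<le> y)"
      using dom[OF i] by (elim exE conjE) (rule that)
    show ?thesis
    proof (rule almost_homogeneousI)
      show "finite (F \<union> G)"
        using F(1) G(1) by simp
      fix s assume "s \<in> [C - (F \<union> G)]\<^bsup>Suc r\<^esup>"
      then have s: "finite s" "card s = Suc r" "s \<subseteq> C - (F \<union> G)"
        by (auto simp: nsets_def)
      define y a where "y = Max s" and "a = s - {y}"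
      have "s \<noteq> {}"
        using s(2) by auto
      then have y: "y \<in> s" "\<And>z. z \<in> s \<Longrightarrow> z \<le> y"
        using s(1) by (auto simp: y_def)
      have a: "finite a" "card a = r" "a \<subseteq> C - (F \<union> G)" "insert y a = s"
        using s y by (auto simp: a_def)
      \<comment> \<open>Since \<open>r > 0\<close>, \<open>Max a\<close> exists; it serves as the
        smaller point \<open>x\<close> in the growth condition.\<close>
      then have "a \<noteq> {}"
        using assms(3) by auto
      then have m: "Max a \<in> a" "a \<subseteq> {..Max a}"
        using a(1) by auto
      then have "Max a < y"
        using y(2)[of "Max a"] by (auto simp: a_def order_less_le)
      then have "h i a \<le> y"
        using G(2)[rule_format, of "Max a" y a] m a(3) s(3) y(1) by blast
      then have "f i (insert y a) = g i a"
        using lim[OF i a(1)] y(1) s(3) C(1) B(1) by blast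
      also have "g i a = c"
        using a by (intro F(2)) (auto simp: nsets_def)
      finally show "f i s = c"
        using a(4) by simp
    qed
  qed
  with C(2) show "\<exists>A. infinite A \<and> (\<forall>i\<in>I. almost_homogeneous (Suc r) (f i) A)"
    by blast
qed

lemma homogenizable_if_2:
  assumes "homogenizable 2 I" "r \<ge> 1"
  shows "homogenizable r I"
  using assms(2)
proof (induction r rule: dec_induct)
  case base
  show ?case using assms(1) by (rule homogenizable_1I)
next
  case (step r)
  then show ?case using assms(1) by (intro homogenizable_Suc) auto
qed

section \<open>Convergence in Cantor cubes\<close>

lemma topspace_cantor_cube [simp]: "topspace (cantor_cube \<kappa>) = Field \<kappa> \<rightarrow>\<^sub>E UNIV"
  by (simp add: cantor_cube_def)

text \<open>The limit consists of the eventual colours of the coordinates. A basic neighbourhood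
  constrains only finitely many coordinates, so the union of their exceptional sets is still
  finite.\<close>

lemma ramsey_cantor_cubeI:
  fixes \<kappa> :: "'k rel"
  assumes "homogenizable r (Field \<kappa>)"
  shows "ramsey_space r (cantor_cube \<kappa>)"
  unfolding ramsey_space_def
proof
  fix f :: "nat set \<Rightarrow> 'k \<Rightarrow> bool"
  assume f: "f \<in> [UNIV]\<^bsup>r\<^esup> \<rightarrow> topspace (cantor_cube \<kappa>)"
  obtain A where A: "infinite A"
    "\<And>k. k \<in> Field \<kappa> \<Longrightarrow> almost_homogeneous r (\<lambda>s. f s k) A"
    by (rule homogenizable_within[OF assms infinite_UNIV_nat, of "\<lambda>k s. f s k"]) blast
  then have "\<forall>k\<in>Field \<kappa>. \<exists>F c. finite F \<and> (\<forall>s\<in>[A - F]\<^bsup>r\<^esup>. f s k = c)"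
    unfolding almost_homogeneous_def constant_on_def by (metis (no_types))
  then obtain F c where F: "\<And>k. k \<in> Field \<kappa> \<Longrightarrow> finite (F k)"
    and c: "\<And>k s. \<lbrakk>k \<in> Field \<kappa>; s \<in> [A - F k]\<^bsup>r\<^esup>\<rbrakk> \<Longrightarrow> f s k = c k"
    by metis
  have "nsets_converges (cantor_cube \<kappa>) r A f (restrict c (Field \<kappa>))"
    unfolding nsets_converges_def
  proof (intro allI impI, elim conjE)
    fix U assume "openin (cantor_cube \<kappa>) U" "restrict c (Field \<kappa>) \<in> U"
    then obtain V where V: "finite {k \<in> Field \<kappa>. V k \<noteq> UNIV}"
      "restrict c (Field \<kappa>) \<in> Pi\<^sub>E (Field \<kappa>) V" "Pi\<^sub>E (Field \<kappa>) V \<subseteq> U"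
      unfolding cantor_cube_def openin_product_topology_alt by auto
    let ?F = "\<Union>k\<in>{k \<in> Field \<kappa>. V k \<noteq> UNIV}. F k"
    show "\<exists>F. finite F \<and> (\<forall>s\<in>[A - F]\<^bsup>r\<^esup>. f s \<in> U)"
    proof (intro exI conjI ballI)
      show "finite ?F"
        using V(1) F by auto
      fix s assume s: "s \<in> [A - ?F]\<^bsup>r\<^esup>"
      have "f s k \<in> V k" if k: "k \<in> Field \<kappa>" for k
      proof (cases "V k = UNIV")
        case False
        then have "s \<in> [A - F k]\<^bsup>r\<^esup>"
          using s k unfolding nsets_def by blast
        then show ?thesis
          using c k V(2) by (auto simp: PiE_iff)
      qed simp
      moreover have "s \<in> [UNIV]\<^bsup>r\<^esup>"
        using s by (auto simp: nsets_def)
      then have "f s \<in> extensional (Field \<kappa>)"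
        using f by (auto simp: PiE_iff)
      ultimately show "f s \<in> U"
        by (intro subsetD[OF V(3)]) (simp add: PiE_iff)
    qed
  qed
  then show "\<exists>p\<in>topspace (cantor_cube \<kappa>). \<exists>B. infinite B \<and> nsets_converges (cantor_cube \<kappa>) r B f p"
    using A(1) by (intro bexI[of _ "restrict c (Field \<kappa>)"]) auto
qed

text \<open>A family of least size is in bijection with the coordinates of the cube, so it forms a
  single function into the cube. A convergent restriction of it would give a common almost
  homogeneous set.\<close>

lemma not_ramsey_cantor_cube_par:
  assumes "n > 0"
  shows "\<not> ramsey_space n (cantor_cube (par n))"
proof
  assume ramsey: "ramsey_space n (cantor_cube (par n))"
  obtain P where P: "par_family n P" "|P| =o par n"
    using par_least(2)[OF assms] by blast
  have "|P| =o |Field (par n)|"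
    using P(2) card_of_Field_ordIso[OF par_least(1)[OF assms]] ordIso_symmetric ordIso_transitive
    by blast
  then obtain e where "bij_betw e P (Field (par n))"
    using card_of_ordIso by blast
  define f where "f s = (\<lambda>k\<in>Field (par n). inv_into P e k s)" for s
  have "f \<in> [UNIV]\<^bsup>n\<^esup> \<rightarrow> topspace (cantor_cube (par n))"
    by (auto simp: f_def)
  then obtain p B where B: "infinite B" "nsets_converges (cantor_cube (par n)) n B f p"
    and p: "p \<in> topspace (cantor_cube (par n))"
    using ramsey unfolding ramsey_space_def by blast
  have "almost_homogeneous n g B" if g: "g \<in> P" for g
  proof -
    have k: "e g \<in> Field (par n)" "inv_into P e (e g) = g"
      using \<open>bij_betw e P (Field (par n))\<close> g by (auto simp: bij_betw_def)
    \<comment> \<open>The subbasic neighbourhood of \<open>p\<close> that fixes only the coordinate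
      \<open>e g\<close> belonging to \<open>g\<close>.\<close>
    let ?U = "{x \<in> topspace (cantor_cube (par n)). x (e g) \<in> {p (e g)}}"
    have "openin (cantor_cube (par n)) ?U"
      unfolding cantor_cube_def
      by (rule openin_continuous_map_preimage[OF continuous_map_product_projection[OF k(1)]]) simp
    moreover have "p \<in> ?U"
      using p by simp
    ultimately obtain F where "finite F" "\<And>s. s \<in> [B - F]\<^bsup>n\<^esup> \<Longrightarrow> f s \<in> ?U"
      using B(2) unfolding nsets_converges_def by meson
    then show ?thesis
      using k by (intro almost_homogeneousI[of F _ _ _ "p (e g)"]) (auto simp: f_def)
  qed
  then show False
    using P(1) B(1) unfolding par_family_def by blast
qed

theorem theorem3p7:
  shows "(\<forall>\<kappa> :: 'k rel. Card_order \<kappa> \<and> \<kappa> <o par 2 \<longrightarrow>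
            (\<forall>r\<ge>1. ramsey_space r (cantor_cube \<kappa>))) \<and>
         \<not> ramsey_space 2 (cantor_cube (par 2))"
proof (intro conjI allI impI, elim conjE)
  fix \<kappa> :: "'k rel" and r :: nat
  assume \<kappa>: "Card_order \<kappa>" "\<kappa> <o par 2" and "1 \<le> r"
  have "|Field \<kappa>| <o par 2"
    using card_of_Field_ordIso[OF \<kappa>(1)] \<kappa>(2) by (rule ordIso_ordLess_trans)
  then have "homogenizable r (Field \<kappa>)"
    using \<open>1 \<le> r\<close> by (rule homogenizable_if_2[OF homogenizable_2I])
  then show "ramsey_space r (cantor_cube \<kappa>)"
    by (rule ramsey_cantor_cubeI)
qed (simp add: not_ramsey_cantor_cube_par)

end
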